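(* Let $\lambda>0$ and $\mu\ge0$, $\mu\ne1$, be real parameters for which $\mathfrak{V}_n(x;\lambda;\mu)$ is defined, and let $n,m$ be nonnegative integers. Then for all real $x,y$, $$\sum_{k=0}^{n}\binom{n}{k}y^{n-k}\,\mathfrak{V}_{m+k}(x;\lambda;\mu)=\sum_{k=0}^{m}\binom{m}{k}(-y)^{m-k}\,\mathfrak{V}_{n+k}(x+y;\lambda;\mu).$$
   Context: For real $\lambda>0$ and real $\mu\ge0$ with $\mu\ne1$, the unified Bernoulli-Euler polynomials of Apostol type are defined by the Taylor expansion at $t=0$ $$\frac{2-\mu+\frac{\mu}{2}t}{\lambda e^{t}+(1-\mu)}e^{xt}=\sum_{n\ge0}\mathfrak{V}_n(x;\lambda;\mu)\frac{t^n}{n!}.$$ This requires the left side to be holomorphic at $t=0$, i.e. $\lambda+1-\mu\ne0$ or $(\lambda,\mu)=(1,2)$. *)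

theory Defs
  imports "HOL-Complex_Analysis.Complex_Analysis"
begin

definition BE_gen :: "real \<Rightarrow> real \<Rightarrow> real \<Rightarrow> complex \<Rightarrow> complex" where
  "BE_gen x lam \<mu> t =
     (2 - of_real \<mu> + of_real \<mu> / 2 * t) / (of_real lam * exp t + (1 - of_real \<mu>))
       * exp (of_real x * t)"

text \<open>The point \<open>t = 0\<close> is left out because the quotient has a removable singularity
  there when \<open>(lam, \<mu>) = (1, 2)\<close>, where HOL evaluates it to \<open>0\<close>.\<close>

definition BE_taylor :: "real \<Rightarrow> real \<Rightarrow> real \<Rightarrow> (nat \<Rightarrow> real) \<Rightarrow> bool" where
  "BE_taylor x lam \<mu> a \<longleftrightarrow>
     (\<exists>r>0. \<forall>t. 0 < norm t \<and> norm t < r \<longrightarrow>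
        (\<lambda>n. of_real (a n) * (t ^ n / fact n)) sums BE_gen x lam \<mu> t)"

definition BE_poly :: "nat \<Rightarrow> real \<Rightarrow> real \<Rightarrow> real \<Rightarrow> real" where
  "BE_poly n x lam \<mu> = (THE a. BE_taylor x lam \<mu> a) n"

lemma BE_powser_unique:
  fixes a b :: "nat \<Rightarrow> complex"
  assumes "r > 0" and "s > 0"
    and a: "\<And>t. 0 < norm t \<Longrightarrow> norm t < r \<Longrightarrow> (\<lambda>n. a n * t ^ n) sums f t"
    and b: "\<And>t. 0 < norm t \<Longrightarrow> norm t < s \<Longrightarrow> (\<lambda>n. b n * t ^ n) sums f t"
  shows "a = b"
proof -
  define d where "d n = a n - b n" for n
  define q where "q = min r s"
  have q: "q > 0" using assms(1,2) by (simp add: q_def)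
  have d: "(\<lambda>n. d n * t ^ n) sums 0" if "t \<noteq> 0" "norm t < q" for t
    using sums_diff[OF a[of t] b[of t]] that by (simp add: d_def q_def algebra_simps)
  have "((\<lambda>_. 0 :: complex) \<longlongrightarrow> d 0) (at (0 :: complex))"
    using powser_limit_0_strong[OF q, of d "\<lambda>_. 0"] d by auto
  then have d0: "d 0 = 0"
    by (simp add: tendsto_const_iff)
  have d': "(\<lambda>n. d n * t ^ n) sums 0" if "norm t < q" for t
  proof (cases "t = 0")
    case True
    then show ?thesis using powser_sums_zero[of d] d0 by simp
  qed (use d that in auto)
  have rad: "conv_radius d \<ge> q"
    by (rule conv_radius_geI_ex') (rule sums_summable[OF d'], simp)
  have "(\<lambda>_. 0 :: complex) has_fps_expansion Abs_fps d"
    unfolding has_fps_expansion_def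
  proof
    show "fps_conv_radius (Abs_fps d) > 0"
      using less_le_trans[OF _ rad, of 0] q by (simp add: fps_conv_radius_def)
    have "eventually (\<lambda>z. z \<in> ball 0 q) (nhds (0 :: complex))"
      using q by (intro eventually_nhds_in_open) auto
    then show "eventually (\<lambda>z. eval_fps (Abs_fps d) z = 0) (nhds 0)"
      by eventually_elim (use d' in \<open>auto simp: eval_fps_def sums_iff\<close>)
  qed
  then have "Abs_fps d = 0"
    using fps_expansion_unique_complex has_fps_expansion_0 by blast
  then show "a = b"
    by (auto simp: fps_eq_iff d_def)
qed

lemma BE_taylor_ex1:
  assumes "lam + 1 - \<mu> \<noteq> 0 \<or> (lam = 1 \<and> \<mu> = 2)"
  shows "\<exists>!a. BE_taylor x lam \<mu> a"
proof -
  define N where "N = fps_const (2 - of_real \<mu> :: complex) + fps_const (of_real \<mu> / 2) * fps_X"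
  define D where "D = fps_const (of_real lam :: complex) * fps_exp 1 + fps_const (1 - of_real \<mu>)"
  define F where "F = N / D * fps_exp (of_real x)"
  have N: "(\<lambda>t. 2 - of_real \<mu> + of_real \<mu> / 2 * t) has_fps_expansion N"
    unfolding N_def by (intro fps_expansion_intros)
  have D: "(\<lambda>t. of_real lam * exp t + (1 - of_real \<mu>)) has_fps_expansion D"
    unfolding D_def by (intro fps_expansion_intros)
  have sub: "D \<noteq> 0 \<and> subdegree D \<le> subdegree N"
  proof (cases "lam + 1 - \<mu> = 0")
    case False
    have "fps_nth D 0 = of_real (lam + 1 - \<mu>)"
      by (simp add: D_def)
    then have "fps_nth D 0 \<noteq> 0" using False by (metis of_real_eq_0_iff)
    then show ?thesis by auto
  next
    case True
    then have lm: "lam = 1" "\<mu> = 2" using assms by auto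
    have "fps_nth D 1 \<noteq> 0" using lm by (simp add: D_def)
    moreover have "subdegree N = 1" using lm by (simp add: N_def)
    ultimately show ?thesis using subdegree_leI by fastforce
  qed
  have "(\<lambda>t. if t = 0 then fps_nth N (subdegree D) / fps_nth D (subdegree D) else
            (2 - of_real \<mu> + of_real \<mu> / 2 * t) / (of_real lam * exp t + (1 - of_real \<mu>)))
          has_fps_expansion N / D"
    using sub by (intro has_fps_expansion_divide N D) auto
  from has_fps_expansion_mult[OF this has_fps_expansion_exp[of "of_real x"]]
  have F: "(\<lambda>t. (if t = 0 then fps_nth N (subdegree D) / fps_nth D (subdegree D) else
            (2 - of_real \<mu> + of_real \<mu> / 2 * t) / (of_real lam * exp t + (1 - of_real \<mu>)))
            * exp (of_real x * t)) has_fps_expansion F"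
    by (simp add: F_def)
  from F have Fr: "fps_conv_radius F > 0"
    and ev: "eventually (\<lambda>t. eval_fps F t = (if t = 0 then fps_nth N (subdegree D) / fps_nth D (subdegree D) else
            (2 - of_real \<mu> + of_real \<mu> / 2 * t) / (of_real lam * exp t + (1 - of_real \<mu>)))
            * exp (of_real x * t)) (nhds 0)"
    by (auto simp: has_fps_expansion_def)
  from ev obtain r1 where r1: "r1 > 0"
    and r1': "\<And>t. norm t < r1 \<Longrightarrow> t \<noteq> 0 \<Longrightarrow> eval_fps F t = BE_gen x lam \<mu> t"
    by (auto simp: eventually_nhds_metric BE_gen_def)
  obtain r2 :: real where r2: "r2 > 0" "r2 < fps_conv_radius F"
    using Fr ereal_dense2[of 0 "fps_conv_radius F"] by (auto simp: zero_ereal_def)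
  define r where "r = min r1 r2"
  have r: "r > 0" using r1 r2 by (simp add: r_def)
  have sm: "(\<lambda>n. fps_nth F n * t ^ n) sums BE_gen x lam \<mu> t" if "0 < norm t" "norm t < r" for t
  proof -
    have "ereal (norm t) < fps_conv_radius F"
      using that r2 by (metis ereal_less_le less_imp_le min.strict_boundedE order_less_trans
          less_ereal.simps(1) r_def)
    then show ?thesis
      using sums_eval_fps[of t F] r1'[of t] that by (simp add: r_def)
  qed
  have cg: "cnj (BE_gen x lam \<mu> (cnj t)) = BE_gen x lam \<mu> t" for t
    by (simp add: BE_gen_def exp_cnj)
  have sc: "(\<lambda>n. cnj (fps_nth F n) * t ^ n) sums BE_gen x lam \<mu> t"
    if "0 < norm t" "norm t < r" for t
  proof -
    have "(\<lambda>n. cnj (fps_nth F n * cnj t ^ n)) sums cnj (BE_gen x lam \<mu> (cnj t))"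
      using sm[of "cnj t"] that by (subst sums_cnj) simp
    then show ?thesis by (simp add: cg)
  qed
  have "fps_nth F = (\<lambda>n. cnj (fps_nth F n))"
    by (rule BE_powser_unique[OF r r sm sc])
  then have re: "of_real (Re (fps_nth F n)) = fps_nth F n" for n
    by (metis Reals_cnj_iff of_real_Re)
  show ?thesis
  proof
    show "BE_taylor x lam \<mu> (\<lambda>n. Re (fps_nth F n) * fact n)"
      unfolding BE_taylor_def using r sm by (intro exI[of _ r]) (auto simp: re)
  next
    fix a assume "BE_taylor x lam \<mu> a"
    then obtain s where s: "s > 0" and
      "\<And>t. 0 < norm t \<Longrightarrow> norm t < s \<Longrightarrow>
         (\<lambda>n. of_real (a n) * (t ^ n / fact n)) sums BE_gen x lam \<mu> t"
      unfolding BE_taylor_def by blast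
    then have sa: "\<And>t. 0 < norm t \<Longrightarrow> norm t < s \<Longrightarrow>
         (\<lambda>n. of_real (a n / fact n) * t ^ n) sums BE_gen x lam \<mu> t"
      by simp
    have "(\<lambda>n. of_real (a n / fact n)) = fps_nth F"
      by (rule BE_powser_unique[OF s r sa sm])
    then have "complex_of_real (a n / fact n) = fps_nth F n" for n by metis
    then have "a n / fact n = Re (fps_nth F n)" for n by (metis Re_complex_of_real)
    then show "a = (\<lambda>n. Re (fps_nth F n) * fact n)"
      by (auto simp: field_simps)
  qed
qed

lemma BE_taylor_BE_poly:
  assumes "lam + 1 - \<mu> \<noteq> 0 \<or> (lam = 1 \<and> \<mu> = 2)"
  shows "BE_taylor x lam \<mu> (\<lambda>n. BE_poly n x lam \<mu>)"
  using theI'[OF BE_taylor_ex1[OF assms, of x]] unfolding BE_poly_def by simp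

end

theory Submission
  imports Defs
begin

text \<open>Multiplying the generating function by \<open>exp (y t)\<close> gives the addition formula
  \<open>V\<^sub>n(x + y) = (\<Sum>k\<le>n. (n choose k) y^(n - k) V\<^sub>k(x))\<close>, which is the case \<open>m = 0\<close>. Pascal's rule
  gives both sides, as functions \<open>A n m\<close>, the recurrence \<open>A n (m + 1) = A (n + 1) m - y * A n m\<close>,
  so they agree for all \<open>m\<close>.\<close>

text \<open>Pascal's rule splits \<open>Suc n choose Suc k\<close>, and an index shift turns the
  \<open>n choose k\<close> part into the sum with \<open>Suc m\<close>. Arbitrary \<open>f\<close>
  and \<open>y\<close> let it serve both sides of the theorem, the right one with
  \<open>- y\<close>.\<close>

lemma binomial_transform_Suc:
  fixes f :: "nat \<Rightarrow> 'a::comm_semiring_1"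
  shows "(\<Sum>k=0..Suc n. of_nat (Suc n choose k) * y ^ (Suc n - k) * f (m + k)) =
         (\<Sum>k=0..n. of_nat (n choose k) * y ^ (n - k) * f (Suc m + k)) +
         y * (\<Sum>k=0..n. of_nat (n choose k) * y ^ (n - k) * f (m + k))"
proof -
  have "y * (\<Sum>k=0..n. of_nat (n choose k) * y ^ (n - k) * f (m + k)) =
        (\<Sum>k=0..n. of_nat (n choose k) * y ^ (Suc n - k) * f (m + k))"
    by (simp add: sum_distrib_left Suc_diff_le mult_ac)
  \<comment> \<open>The added term vanishes since \<open>n choose Suc n\<close> is 0; after
    splitting off \<open>k = 0\<close> the range is again \<open>0..n\<close>.\<close>
  also have "\<dots> = (\<Sum>k=0..Suc n. of_nat (n choose k) * y ^ (Suc n - k) * f (m + k))"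
    by (simp add: binomial_eq_0)
  also have "\<dots> = y ^ Suc n * f m +
      (\<Sum>k=0..n. of_nat (n choose Suc k) * y ^ (n - k) * f (Suc m + k))"
    by (subst sum.atLeast0_atMost_Suc_shift) simp
  finally show ?thesis
    by (subst sum.atLeast0_atMost_Suc_shift) (simp add: algebra_simps sum.distrib)
qed

lemma BE_gen_add: "BE_gen (x + y) lam \<mu> t = BE_gen x lam \<mu> t * exp (of_real y * t)"
  by (simp add: BE_gen_def exp_add ring_distribs)

text \<open>The new coefficients are those of the Cauchy product of the given series with the
  exponential series of \<open>y * t\<close>.\<close>

lemma BE_taylor_add:
  assumes "BE_taylor x lam \<mu> a"
  shows "BE_taylor (x + y) lam \<mu> (\<lambda>n. \<Sum>k=0..n. real (n choose k) * y ^ (n - k) * a k)"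
proof -
  obtain r where r: "r > 0" and
    a: "\<And>t. 0 < norm t \<Longrightarrow> norm t < r \<Longrightarrow>
      (\<lambda>n. of_real (a n) * (t ^ n / fact n)) sums BE_gen x lam \<mu> t"
    using assms unfolding BE_taylor_def by blast
  have "(\<lambda>n. of_real (\<Sum>k=0..n. real (n choose k) * y ^ (n - k) * a k) * (t ^ n / fact n))
          sums BE_gen (x + y) lam \<mu> t" if t: "0 < norm t" "norm t < r" for t :: complex
  proof -
    define u where "u n = complex_of_real (a n / fact n) * t ^ n" for n
    define v where "v n = (of_real y * t) ^ n /\<^sub>R fact n" for n
    have u: "u sums BE_gen x lam \<mu> t"
      using a[OF t] by (simp add: u_def[abs_def])
    have v: "v sums exp (of_real y * t)"
      unfolding v_def[abs_def] by (rule exp_converges)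
    \<comment> \<open>Convergence at the larger radius \<open>s\<close> forces absolute convergence
      at \<open>t\<close>, as the Cauchy product requires.\<close>
    obtain s where s: "norm t < s" "s < r"
      using t dense by blast
    then have "0 < s"
      using t by linarith
    then have s_norm: "0 < norm (complex_of_real s)" "norm (complex_of_real s) < r"
      using s by auto
    have "summable (\<lambda>n. complex_of_real (a n / fact n) * of_real s ^ n)"
      using sums_summable[OF a[OF s_norm]] by simp
    then have un: "summable (\<lambda>n. norm (u n))"
      unfolding u_def using s t by (intro powser_insidea) auto
    have vn: "summable (\<lambda>n. norm (v n))"
      unfolding v_def by (rule summable_norm_exp)
    have uv: "(\<lambda>n. \<Sum>k\<le>n. u k * v (n - k)) sums BE_gen (x + y) lam \<mu> t"
      using Cauchy_product_sums[OF un vn] u v by (simp add: BE_gen_add sums_iff)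
    \<comment> \<open>The binomial coefficient arises from
      \<open>1 / (fact k * fact (n - k)) = (n choose k) / fact n\<close>.\<close>
    have "u k * v (n - k) =
        of_real (real (n choose k) * y ^ (n - k) * a k) * (t ^ n / fact n)" if "k \<le> n" for k n
    proof -
      have "t ^ k * t ^ (n - k) = t ^ n"
        using that by (simp flip: power_add)
      then show ?thesis
        by (simp add: u_def v_def scaleR_conv_of_real binomial_fact[OF that]
            power_mult_distrib field_simps)
    qed
    then have "(\<Sum>k\<le>n. u k * v (n - k)) =
        of_real (\<Sum>k=0..n. real (n choose k) * y ^ (n - k) * a k) * (t ^ n / fact n)" for n
      by (simp only: of_real_sum sum_distrib_right atLeast0AtMost) (intro sum.cong, auto)
    with uv show ?thesis by simp
  qed
  with r show ?thesis unfolding BE_taylor_def by blast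
qed

text \<open>Taylor coefficients are unique, so the sequence from \<open>BE_taylor_add\<close> must
  be the one that \<open>BE_poly\<close> selects at \<open>x + y\<close>.\<close>

lemma BE_poly_add:
  assumes "lam + 1 - \<mu> \<noteq> 0 \<or> (lam = 1 \<and> \<mu> = 2)"
  shows "BE_poly n (x + y) lam \<mu> =
         (\<Sum>k=0..n. real (n choose k) * y ^ (n - k) * BE_poly k x lam \<mu>)"
  unfolding BE_poly_def[of n "x + y"]
  by (rule fun_cong[OF the1_equality[where P = "BE_taylor (x + y) lam \<mu>"]])
     (rule BE_taylor_ex1[OF assms], rule BE_taylor_add[OF BE_taylor_BE_poly[OF assms]])

theorem theorem10:
  fixes lam \<mu> x y :: real and n m :: nat
  assumes "lam > 0" and "\<mu> \<ge> 0" and "\<mu> \<noteq> 1"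
    and "lam + 1 - \<mu> \<noteq> 0 \<or> (lam = 1 \<and> \<mu> = 2)"
  shows "(\<Sum>k=0..n. real (n choose k) * y ^ (n - k) * BE_poly (m + k) x lam \<mu>) =
         (\<Sum>k=0..m. real (m choose k) * (- y) ^ (m - k) * BE_poly (n + k) (x + y) lam \<mu>)"
proof (induction m arbitrary: n)
  case 0
  show ?case using BE_poly_add[OF assms(4)] by simp
next
  case (Suc m)
  \<comment> \<open>Raising \<open>m\<close> on either side involves the values at
    \<open>(n, m)\<close> and \<open>(Suc n, m)\<close>, so the induction hypothesis is used at both
    \<open>n\<close> and \<open>Suc n\<close>.\<close>
  show ?case
    using binomial_transform_Suc[of n y "\<lambda>k. BE_poly k x lam \<mu>" m]
      binomial_transform_Suc[of m "- y" "\<lambda>k. BE_poly k (x + y) lam \<mu>" n]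
      Suc[of n] Suc[of "Suc n"]
    by (simp only:)
qed

end
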